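(* Let $X$ be a semi-metric space and let $\mathcal{M}_X=\{d:X\times X\to\mathbb{R}\;;\; d \text{ is a semi-metric on } X\}$. Then $(\mathcal{M}_X,+,\cdot)$ is a semi-vector space over $\mathbb{R}_0^+$, where $+$ is pointwise addition and $\cdot$ is pointwise multiplication by scalars in $\mathbb{R}_0^+$.
   Context: $\mathbb{R}_0^+=[0,\infty)$. A semi-metric on a set $X$ is a function $d:X\times X\to\mathbb{R}$ with $d(x,y)\ge 0$, $d(x,x)=0$, $d(x,y)=d(y,x)$ and $d(x,z)\le d(x,y)+d(y,z)$ for all $x,y,z\in X$ (i.e. a pseudometric; $d(x,y)=0$ need not imply $x=y$). A semi-metric space is a set endowed with a semi-metric. A semi-vector space over $\mathbb{R}_0^+$ is a set $V$ with operations $+:V\times V\to V$ and $\cdot:\mathbb{R}_0^+\times V\to V$ such that: (1) $(V,+)$ is an abelian monoid satisfying the cancellation law $u+v=u+w\Rightarrow v=w$; (2) $\alpha(u+v)=\alpha u+\alpha v$; (3) $(\alpha+\beta)v=\alpha v+\beta v$; (4) $(\alpha\beta)v=\alpha(\beta v)$; (5) $1v=v$. *)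

theory Defs
  imports Complex_Main "HOL-Library.FuncSet" "HOL-Algebra.Divisibility"
begin

locale semi_metric_space =
  fixes X :: "'a set" and d :: "'a \<times> 'a \<Rightarrow> real"
  assumes nonneg: "\<lbrakk>x \<in> X; y \<in> X\<rbrakk> \<Longrightarrow> 0 \<le> d (x, y)"
    and self_zero: "x \<in> X \<Longrightarrow> d (x, x) = 0"
    and sym: "\<lbrakk>x \<in> X; y \<in> X\<rbrakk> \<Longrightarrow> d (x, y) = d (y, x)"
    and triangle: "\<lbrakk>x \<in> X; y \<in> X; z \<in> X\<rbrakk> \<Longrightarrow> d (x, z) \<le> d (x, y) + d (y, z)"

text \<open>Scalars are the nonnegative reals, the set \<open>{0..}\<close>; the value of \<open>smult\<close> at a negative
  scalar is irrelevant.\<close>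

locale semi_vector_space =
  fixes V :: "'v set" and add :: "'v \<Rightarrow> 'v \<Rightarrow> 'v" and zero :: 'v
    and smult :: "real \<Rightarrow> 'v \<Rightarrow> 'v"
  assumes add_comm_monoid_cancel: "comm_monoid_cancel \<lparr>carrier = V, mult = add, one = zero\<rparr>"
    and smult_closed: "\<lbrakk>\<alpha> \<in> {0..}; v \<in> V\<rbrakk> \<Longrightarrow> smult \<alpha> v \<in> V"
    and smult_add: "\<lbrakk>\<alpha> \<in> {0..}; u \<in> V; v \<in> V\<rbrakk> \<Longrightarrow>
      smult \<alpha> (add u v) = add (smult \<alpha> u) (smult \<alpha> v)"
    and add_smult: "\<lbrakk>\<alpha> \<in> {0..}; \<beta> \<in> {0..}; v \<in> V\<rbrakk> \<Longrightarrow>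
      smult (\<alpha> + \<beta>) v = add (smult \<alpha> v) (smult \<beta> v)"
    and mult_smult: "\<lbrakk>\<alpha> \<in> {0..}; \<beta> \<in> {0..}; v \<in> V\<rbrakk> \<Longrightarrow>
      smult (\<alpha> * \<beta>) v = smult \<alpha> (smult \<beta> v)"
    and one_smult: "v \<in> V \<Longrightarrow> smult 1 v = v"

text \<open>Functions on \<open>X \<times> X\<close> are represented extensionally (value \<open>undefined\<close> off \<open>X \<times> X\<close>), so that
  equality in HOL is equality of functions on \<open>X \<times> X\<close>.\<close>

definition semi_metrics :: "'a set \<Rightarrow> ('a \<times> 'a \<Rightarrow> real) set" where
  "semi_metrics X = {d \<in> X \<times> X \<rightarrow>\<^sub>E UNIV. semi_metric_space X d}"

definition semi_metric_add ::
    "'a set \<Rightarrow> ('a \<times> 'a \<Rightarrow> real) \<Rightarrow> ('a \<times> 'a \<Rightarrow> real) \<Rightarrow> 'a \<times> 'a \<Rightarrow> real" where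
  "semi_metric_add X d e = (\<lambda>p \<in> X \<times> X. d p + e p)"

definition semi_metric_zero :: "'a set \<Rightarrow> 'a \<times> 'a \<Rightarrow> real" where
  "semi_metric_zero X = (\<lambda>p \<in> X \<times> X. 0)"

definition semi_metric_smult :: "'a set \<Rightarrow> real \<Rightarrow> ('a \<times> 'a \<Rightarrow> real) \<Rightarrow> 'a \<times> 'a \<Rightarrow> real" where
  "semi_metric_smult X \<alpha> d = (\<lambda>p \<in> X \<times> X. \<alpha> * d p)"

end

theory Submission
  imports Defs
begin

text \<open>The conditions defining a semi-metric are homogeneous linear equations and inequalities
  in the values of \<open>d\<close>, so they cut out a convex cone in the real functions on
  \<open>X \<times> X\<close>: see \<open>semi_metric_add_closed\<close> and
  \<open>semi_metric_smult_closed\<close>. The algebraic laws and cancellation are then inherited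
  pointwise from the reals; the remaining care concerns the value \<open>undefined\<close> off
  \<open>X \<times> X\<close>.\<close>

text \<open>Reduces an equation between semi-metrics to an equation at each point of
  \<open>X \<times> X\<close>.\<close>

lemma semi_metrics_extensional: "d \<in> semi_metrics X \<Longrightarrow> d \<in> extensional (X \<times> X)"
  by (simp add: semi_metrics_def PiE_def)

lemma semi_metric_zero_closed: "semi_metric_zero X \<in> semi_metrics X"
  by (simp add: semi_metrics_def semi_metric_zero_def semi_metric_space_def)

lemma semi_metric_add_closed:
  assumes "d \<in> semi_metrics X" "e \<in> semi_metrics X"
  shows "semi_metric_add X d e \<in> semi_metrics X"
proof -
  interpret d: semi_metric_space X d using assms by (simp add: semi_metrics_def)
  interpret e: semi_metric_space X e using assms by (simp add: semi_metrics_def)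
  have "semi_metric_space X (semi_metric_add X d e)"
  proof
    fix x y z assume "x \<in> X" "y \<in> X" "z \<in> X"
    then show "semi_metric_add X d e (x, z)
        \<le> semi_metric_add X d e (x, y) + semi_metric_add X d e (y, z)"
      using d.triangle [of x y z] e.triangle [of x y z] by (simp add: semi_metric_add_def)
  qed (simp_all add: semi_metric_add_def d.nonneg e.nonneg d.self_zero e.self_zero d.sym e.sym)
  then show ?thesis by (simp add: semi_metrics_def semi_metric_add_def)
qed

text \<open>A scalar \<alpha> \<ge> 0 preserves the direction of inequalities, so positivity and the
  triangle inequality survive scaling.\<close>

lemma semi_metric_smult_closed:
  assumes "0 \<le> \<alpha>" "d \<in> semi_metrics X"
  shows "semi_metric_smult X \<alpha> d \<in> semi_metrics X"
proof -
  interpret d: semi_metric_space X d using assms by (simp add: semi_metrics_def)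
  have "semi_metric_space X (semi_metric_smult X \<alpha> d)"
  proof
    fix x y z assume "x \<in> X" "y \<in> X" "z \<in> X"
    then show "semi_metric_smult X \<alpha> d (x, z)
        \<le> semi_metric_smult X \<alpha> d (x, y) + semi_metric_smult X \<alpha> d (y, z)"
      using mult_left_mono [OF d.triangle [of x y z] assms(1)]
      by (simp add: semi_metric_smult_def distrib_left)
  qed (simp_all add: semi_metric_smult_def assms d.nonneg d.self_zero d.sym)
  then show ?thesis by (simp add: semi_metrics_def semi_metric_smult_def)
qed

text \<open>Both sides are restrictions to \<open>X \<times> X\<close>, so associativity of real
  addition on that set suffices.\<close>

lemma semi_metric_add_assoc:
  "semi_metric_add X (semi_metric_add X d e) f = semi_metric_add X d (semi_metric_add X e f)"
  by (auto simp: semi_metric_add_def restrict_def)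

lemma semi_metric_add_commute: "semi_metric_add X d e = semi_metric_add X e d"
  by (simp add: semi_metric_add_def add.commute)

lemma semi_metric_add_zero_left:
  "d \<in> semi_metrics X \<Longrightarrow> semi_metric_add X (semi_metric_zero X) d = d"
  by (rule extensionalityI [OF _ semi_metrics_extensional])
    (auto simp: semi_metric_add_def semi_metric_zero_def)

text \<open>Real addition cancels at each point of \<open>X \<times> X\<close>. Cancelling on the
  right is the form that \<open>comm_monoid_cancelI\<close> asks for; commutativity yields the other
  side.\<close>

lemma semi_metric_add_right_cancel:
  assumes "d \<in> semi_metrics X" "e \<in> semi_metrics X"
    and "semi_metric_add X d f = semi_metric_add X e f"
  shows "d = e"
proof (rule extensionalityI [OF semi_metrics_extensional semi_metrics_extensional])
  fix p assume "p \<in> X \<times> X"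
  with fun_cong [OF assms(3), of p] show "d p = e p"
    by (simp add: semi_metric_add_def)
qed (fact assms)+

lemma semi_metrics_comm_monoid_cancel:
  "comm_monoid_cancel
    \<lparr>carrier = semi_metrics X, mult = semi_metric_add X, one = semi_metric_zero X\<rparr>"
proof (rule comm_monoid_cancelI)
  show "comm_monoid
      \<lparr>carrier = semi_metrics X, mult = semi_metric_add X, one = semi_metric_zero X\<rparr>"
    by (rule comm_monoidI)
      (simp_all add: semi_metric_zero_closed semi_metric_add_closed semi_metric_add_assoc
        semi_metric_add_zero_left, rule semi_metric_add_commute)
qed (auto intro: semi_metric_add_right_cancel)

theorem theorem3p8:
  fixes X :: "'a set" and d\<^sub>X :: "'a \<times> 'a \<Rightarrow> real"
  assumes "semi_metric_space X d\<^sub>X"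
  shows "semi_vector_space (semi_metrics X)
    (semi_metric_add X) (semi_metric_zero X) (semi_metric_smult X)"
proof (rule semi_vector_space.intro)
  fix d assume "d \<in> semi_metrics X"
  then show "semi_metric_smult X 1 d = d"
    \<comment> \<open>Multiplying by 1 still restricts to \<open>X \<times> X\<close>; this returns
      \<open>d\<close> itself because \<open>d\<close> is extensional.\<close>
    by (intro extensionalityI [OF _ semi_metrics_extensional])
      (auto simp: semi_metric_smult_def)
next
  fix \<alpha> :: real and d :: "'a \<times> 'a \<Rightarrow> real"
  assume "\<alpha> \<in> {0..}" "d \<in> semi_metrics X"
  then show "semi_metric_smult X \<alpha> d \<in> semi_metrics X"
    by (simp add: semi_metric_smult_closed)
\<comment> \<open>Besides the monoid axiom, the two distributive laws and the mixed associative law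
  remain; after unfolding they are ring identities at each point of \<open>X \<times> X\<close>,
  with \<open>undefined\<close> on both sides elsewhere.\<close>
qed (auto simp: semi_metrics_comm_monoid_cancel semi_metric_smult_def semi_metric_add_def
    restrict_def algebra_simps)

end
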